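(* Let $X$ be a real normed space, let $\mathcal F$ be a directionally fine family of closed cones in $X$, and let $L,K\subset X$ be cones such that $L\cap K=\{0_X\}$, with $K$ closed and $L$ locally compact. Then there exist a continuous positively homogeneous function $\Phi:X\to\mathbb R$ and $\gamma_L>0$ such that $|\Phi(x)|\le\|x\|$ for every $x\in X$ and \[ \Phi(l)\ge\gamma_L\|l\|>0>\Phi(k)\qquad\forall l\in L\setminus\{0_X\},\ \forall k\in K\setminus\{0_X\}. \]
   Context: $S_X$ is the unit sphere, $B(x,r)=\{y\in X:\|y-x\|\le r\}$, $\operatorname{cone}(A)=\{ta:t\ge0,\ a\in A\}$. A nonempty set $C\subset X$ is a cone if $tC\subset C$ for every $t\ge 0$; all cones are assumed proper, i.e. $\{0_X\}\subsetneq C\subsetneq X$ (not necessarily convex). A family $\mathcal F$ of closed cones in $X$ is directionally fine if for every $u\in S_X$ and $\varepsilon\in(0,1)$ there exists $C\in\mathcal F$ with $u\in\operatorname{int}C\subset C\subset\operatorname{cone}B(u,\varepsilon)$. A cone $L$ is locally compact if for every $x\in L$ there is $r>0$ with $L\cap B(x,r)$ norm compact. A mapping is positively homogeneous if $\Phi(tx)=t\Phi(x)$ for all $t\ge0$, $x\in X$. *)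

theory Defs
  imports "HOL-Analysis.Analysis"
begin

text \<open>Every cone is assumed proper. The library predicate \<^const>\<open>cone\<close> also admits the
  empty set, \<open>{0}\<close> and the whole space; these are excluded here. Convexity is not required.\<close>

definition proper_cone :: "'a::real_vector set \<Rightarrow> bool"
  where "proper_cone C \<longleftrightarrow> cone C \<and> {0} \<subset> C \<and> C \<subset> UNIV"

definition cone_gen :: "'a::real_vector set \<Rightarrow> 'a set"
  where "cone_gen A = {t *\<^sub>R a | t a. t \<ge> 0 \<and> a \<in> A}"

definition directionally_fine :: "'a::real_normed_vector set set \<Rightarrow> bool"
  where "directionally_fine \<F> \<longleftrightarrow>
    (\<forall>u\<in>sphere 0 1. \<forall>\<epsilon>\<in>{0<..<1}. \<exists>C\<in>\<F>.
       u \<in> interior C \<and> interior C \<subseteq> C \<and> C \<subseteq> cone_gen (cball u \<epsilon>))"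

definition locally_compact_cone :: "'a::real_normed_vector set \<Rightarrow> bool"
  where "locally_compact_cone L \<longleftrightarrow>
    proper_cone L \<and> (\<forall>x\<in>L. \<exists>r>0. compact (L \<inter> cball x r))"

definition positively_homogeneous :: "('a::real_vector \<Rightarrow> 'b::real_vector) \<Rightarrow> bool"
  where "positively_homogeneous \<Phi> \<longleftrightarrow> (\<forall>t\<ge>0. \<forall>x. \<Phi> (t *\<^sub>R x) = t *\<^sub>R \<Phi> x)"

end

theory Submission
  imports Defs
begin

text \<open>The distance to a closed cone \<open>K\<close> is Lipschitz, positively homogeneous, bounded by the norm,
  and vanishes exactly on \<open>K\<close>. Local compactness of \<open>L\<close> at the origin makes some slice
  \<open>L \<inter> sphere 0 r\<close> compact, so \<open>infdist l K \<ge> c * norm l\<close> on \<open>L\<close> for some \<open>c > 0\<close>, and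
  \<open>\<Phi> x = infdist x K - c / 2 * norm x\<close> separates.\<close>

text \<open>Scaling by \<open>t\<close> maps \<open>K\<close> into itself, so every competitor
  \<open>a\<close> for \<open>x\<close> yields the competitor \<open>t *\<^sub>R a\<close> for
  \<open>t *\<^sub>R x\<close>, at \<open>t\<close> times the distance.\<close>

lemma infdist_cone_scaleR_le:
  fixes K :: "'a::real_normed_vector set"
  assumes "cone K" "0 < t"
  shows "infdist (t *\<^sub>R x) K \<le> t * infdist x K"
proof (cases "K = {}")
  case False
  have "infdist (t *\<^sub>R x) K / t \<le> dist x a" if "a \<in> K" for a
  proof -
    have "t *\<^sub>R a \<in> K"
      using assms that by (simp add: cone_def)
    then have "infdist (t *\<^sub>R x) K \<le> dist (t *\<^sub>R x) (t *\<^sub>R a)"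
      by (rule infdist_le)
    also have "\<dots> = t * dist x a"
      using assms(2) by (simp add: dist_norm flip: scaleR_diff_right)
    finally show ?thesis
      using assms(2) by (simp add: field_simps)
  qed
  then have "infdist (t *\<^sub>R x) K / t \<le> infdist x K"
    using False by (simp add: infdist_notempty cINF_greatest)
  then show ?thesis
    using assms(2) by (simp add: field_simps)
\<comment> \<open>By convention \<open>infdist\<close> to the empty set is 0.\<close>
qed (simp add: infdist_def)

lemma infdist_cone_scaleR:
  fixes K :: "'a::real_normed_vector set"
  assumes "cone K" "0 \<le> t"
  shows "infdist (t *\<^sub>R x) K = t * infdist x K"
proof (cases "t = 0 \<or> K = {}")
  case True
  then show ?thesis
    using cone_contains_0[OF assms(1)] by (auto simp: infdist_def[of _ "{}"])
next
  case False
  then have t: "0 < t"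
    using assms(2) by simp
  \<comment> \<open>The reverse inequality is the one-sided bound for the factor
    \<open>inverse t\<close> at the point \<open>t *\<^sub>R x\<close>.\<close>
  have "infdist (inverse t *\<^sub>R t *\<^sub>R x) K \<le> inverse t * infdist (t *\<^sub>R x) K"
    using t by (intro infdist_cone_scaleR_le assms(1)) simp
  then have "t * infdist x K \<le> infdist (t *\<^sub>R x) K"
    using t by (simp add: field_simps)
  then show ?thesis
    using infdist_cone_scaleR_le[OF assms(1) t, of x] by simp
qed

lemma infdist_cone_le_norm:
  fixes K :: "'a::real_normed_vector set"
  assumes "0 \<in> K"
  shows "infdist x K \<le> norm x"
  using infdist_le[OF assms, of x] by simp

text \<open>A compact slice of \<open>L\<close> away from the origin misses the closed set
  \<open>K\<close>, so the distance to \<open>K\<close> has a positive minimum there; homogeneity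
  carries the bound to all of \<open>L\<close>.\<close>

lemma locally_compact_cone_infdist_bound:
  fixes L K :: "'a::real_normed_vector set"
  assumes L: "locally_compact_cone L" and K: "cone K" "closed K" and LK: "L \<inter> K = {0}"
  obtains c where "0 < c" "\<And>l. l \<in> L \<Longrightarrow> c * norm l \<le> infdist l K"
proof -
  have coneL: "cone L" and L0: "0 \<in> L" and "L \<noteq> {0}"
    using L by (auto simp: locally_compact_cone_def proper_cone_def)
  then obtain e where e: "e \<in> L" "e \<noteq> 0"
    by blast
  obtain r where r: "0 < r" "compact (L \<inter> cball 0 r)"
    using L L0 unfolding locally_compact_cone_def by blast
  define S where "S = L \<inter> sphere 0 r"
  have "S = (L \<inter> cball 0 r) \<inter> {x. norm x = r}"
    by (auto simp: S_def)
  moreover have "closed {x::'a. norm x = r}"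
    by (intro closed_Collect_eq continuous_intros)
  ultimately have "compact S"
    using compact_Int_closed[OF r(2)] by simp
  \<comment> \<open>Radial projection onto the slice. Applied to \<open>e\<close> it makes
    \<open>S\<close> nonempty, so that a minimum is attained; applied to \<open>l\<close> it
    transfers the bound.\<close>
  have scaled: "(r / norm l) *\<^sub>R l \<in> S" if "l \<in> L" "l \<noteq> 0" for l
    using that coneL r(1) by (simp add: S_def cone_def)
  then have "S \<noteq> {}"
    using e by blast
  moreover have "continuous_on S (\<lambda>x. infdist x K)"
    by (intro continuous_intros)
  ultimately obtain m where m: "m \<in> S" "\<And>s. s \<in> S \<Longrightarrow> infdist m K \<le> infdist s K"
    using continuous_attains_inf[OF \<open>compact S\<close>, of "\<lambda>x. infdist x K"] by blast
  have "m \<in> L" "m \<noteq> 0"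
    using m(1) r(1) by (auto simp: S_def)
  then have "m \<notin> K"
    using LK by blast
  then have "0 < infdist m K"
    using infdist_pos_not_in_closed[OF K(2)] LK by blast
  show ?thesis
  proof
    \<comment> \<open>Points of \<open>S\<close> have norm \<open>r\<close>, hence the minimum per
      unit of norm is the right constant.\<close>
    show "0 < infdist m K / r"
      using \<open>0 < infdist m K\<close> r(1) by simp
    show "infdist m K / r * norm l \<le> infdist l K" if "l \<in> L" for l
    proof (cases "l = 0")
      case False
      have "infdist m K \<le> r / norm l * infdist l K"
        using m(2)[OF scaled[OF that False]] r(1)
        by (simp add: infdist_cone_scaleR[OF K(1)])
      then show ?thesis
        using False r(1) by (simp add: field_simps)
    qed (simp add: infdist_nonneg)
  qed
qed

theorem corollary3p24:
  fixes \<F> :: "'a::real_normed_vector set set" and L K :: "'a set"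
  assumes "\<And>C. C \<in> \<F> \<Longrightarrow> proper_cone C \<and> closed C"
    and "directionally_fine \<F>"
    and "proper_cone L" and "proper_cone K"
    and "L \<inter> K = {0}"
    and "closed K"
    and "locally_compact_cone L"
  shows "\<exists>(\<Phi> :: 'a \<Rightarrow> real) \<gamma>\<^sub>L. continuous_on UNIV \<Phi> \<and> positively_homogeneous \<Phi> \<and> \<gamma>\<^sub>L > 0 \<and>
    (\<forall>x. \<bar>\<Phi> x\<bar> \<le> norm x) \<and>
    (\<forall>l\<in>L - {0}. \<forall>k\<in>K - {0}.
       \<Phi> l \<ge> \<gamma>\<^sub>L * norm l \<and> \<gamma>\<^sub>L * norm l > 0 \<and> 0 > \<Phi> k)"
proof -
  have K: "cone K" "0 \<in> K"
    using assms(4) by (auto simp: proper_cone_def)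
  obtain c where c: "0 < c" "\<And>l. l \<in> L \<Longrightarrow> c * norm l \<le> infdist l K"
    using locally_compact_cone_infdist_bound[OF assms(7) K(1) assms(6,5)] by blast
  obtain e where e: "e \<in> L" "e \<noteq> 0"
    using assms(3) by (auto simp: proper_cone_def)
  \<comment> \<open>Any nonzero point of \<open>L\<close> forces \<open>c \<le> 1\<close>, which
    later gives the lower bound \<open>- norm x \<le> \<Phi> x\<close>.\<close>
  have "c * norm e \<le> 1 * norm e"
    using c(2)[OF e(1)] infdist_cone_le_norm[OF K(2), of e] by simp
  then have "c \<le> 1"
    using e(2) by simp
  \<comment> \<open>Subtracting only half of \<open>c\<close> leaves the margin
    \<open>c / 2 * norm l\<close> on \<open>L\<close>, while on \<open>K\<close>, where the distance
    vanishes, \<open>\<Phi> k = - (c / 2) * norm k\<close>.\<close>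
  define \<Phi> where "\<Phi> = (\<lambda>x. infdist x K - c / 2 * norm x)"
  have cont: "continuous_on UNIV \<Phi>"
    unfolding \<Phi>_def by (intro continuous_intros)
  have hom: "positively_homogeneous \<Phi>"
    by (simp add: positively_homogeneous_def \<Phi>_def infdist_cone_scaleR[OF K(1)] right_diff_distrib)
  have bound: "\<bar>\<Phi> x\<bar> \<le> norm x" for x
  proof -
    have "0 \<le> c / 2 * norm x" "c / 2 * norm x \<le> 1 * norm x"
      using c(1) \<open>c \<le> 1\<close> by (simp, intro mult_right_mono) auto
    then show ?thesis
      using infdist_nonneg[of x K] infdist_cone_le_norm[OF K(2), of x]
      unfolding \<Phi>_def by linarith
  qed
  have pos: "c / 2 * norm l \<le> \<Phi> l" if "l \<in> L" for l
    using c(2)[OF that] by (simp add: \<Phi>_def)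
  have neg: "\<Phi> k < 0" if "k \<in> K" "k \<noteq> 0" for k
    using that c(1) by (simp add: \<Phi>_def)
  show ?thesis
    using cont hom bound pos neg c(1)
    by (intro exI[of _ \<Phi>] exI[of _ "c / 2"]) auto
qed

end
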